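(* Let $\mu=x_0i+y_0j+z_0k\in\mathcal H$ with $m=N(\mu)$ squarefree, where exactly one of $x_0,y_0,z_0$ is zero. Let $R_\mu(\rho)$ be an ideal of $\mathcal O(\mu)$ with right pseudo generator $\rho$, and write $\mu'=\rho\mu\rho^{-1}=x_1i+y_1j+z_1k$. Then the ideal class $[R_\mu(\rho)]$ is ambiguous if and only if exactly one of $x_1,y_1,z_1$ is zero.
   Context: Quaternions with Hamilton multiplication, $\Re$, $N$, conjugate $\overline q$, $q^{-1}=\overline q/N(q)$. $\mathcal H$ = Hurwitz integral quaternions $(a+bi+cj+dk)/2$, $a,b,c,d\in\mathbb Z$ of equal parity. With $r=1$ if $m\not\equiv3\pmod4$, $r=2$ otherwise, and $\omega=(r-1+\mu)/r$, $\mathcal O(\mu)=\mathbb Z+\mathbb Z\omega$ is a commutative subring of $\mathcal H$ isomorphic to the maximal order of $\mathbb Q(\sqrt{-m})$. Every nonzero ideal of $\mathcal O(\mu)$ has $\mathbb Z$-basis $c[a,b+\omega]$ ($c,a>0$); its right pseudo generator is $c\cdot\gcd_r(a,b+\omega)$ (greatest-norm common right divisor in $\mathcal H$, unique up to a unit on the left), and $R_\mu(\rho)=\{\xi\rho:\xi\in\mathcal H,\ \xi\rho\in\mathcal O(\mu)\}$ is the ideal with right pseudo generator $\rho$. Two ideals $\mathfrak a,\mathfrak b$ are equivalent if $\alpha\mathfrak a=\beta\mathfrak b$ for some nonzero $\alpha,\beta\in\mathcal O(\mu)$; the class $[\mathfrak a]$ is ambiguous if $[\mathfrak a]=[\overline{\mathfrak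 a}]$, where $\overline{\mathfrak a}=\{\overline x:x\in\mathfrak a\}$. *)

theory Defs
  imports Complex_Main "HOL-Algebra.Ideal" "HOL-Computational_Algebra.Squarefree"
begin

text \<open>\<^term>\<open>Quat a b c d\<close> stands for $a + bi + cj + dk$.\<close>

datatype quat = Quat (qre: real) (qi: real) (qj: real) (qk: real)

definition qcnj :: "quat \<Rightarrow> quat" where
  "qcnj q = Quat (qre q) (- qi q) (- qj q) (- qk q)"

definition qN :: "quat \<Rightarrow> real" where
  "qN q = (qre q)\<^sup>2 + (qi q)\<^sup>2 + (qj q)\<^sup>2 + (qk q)\<^sup>2"

lemma qN_eq_0_iff: "qN q = 0 \<longleftrightarrow> q = Quat 0 0 0 0"
  by (cases q) (auto simp: qN_def add_nonneg_eq_0_iff)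

text \<open>The inverse is $\overline q / N(q)$, hence $0$ at $q = 0$.\<close>

instantiation quat :: division_ring
begin

definition zero_quat :: quat where "0 = Quat 0 0 0 0"
definition one_quat :: quat where "1 = Quat 1 0 0 0"
definition plus_quat :: "quat \<Rightarrow> quat \<Rightarrow> quat" where
  "p + q = Quat (qre p + qre q) (qi p + qi q) (qj p + qj q) (qk p + qk q)"
definition uminus_quat :: "quat \<Rightarrow> quat" where
  "- q = Quat (- qre q) (- qi q) (- qj q) (- qk q)"
definition minus_quat :: "quat \<Rightarrow> quat \<Rightarrow> quat" where
  "p - q = Quat (qre p - qre q) (qi p - qi q) (qj p - qj q) (qk p - qk q)"
definition times_quat :: "quat \<Rightarrow> quat \<Rightarrow> quat" where
  "p * q = Quat
     (qre p * qre q - qi p * qi q - qj p * qj q - qk p * qk q)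
     (qre p * qi q + qi p * qre q + qj p * qk q - qk p * qj q)
     (qre p * qj q - qi p * qk q + qj p * qre q + qk p * qi q)
     (qre p * qk q + qi p * qj q - qj p * qi q + qk p * qre q)"
definition inverse_quat :: "quat \<Rightarrow> quat" where
  "inverse q = Quat (qre q / qN q) (- qi q / qN q) (- qj q / qN q) (- qk q / qN q)"
definition divide_quat :: "quat \<Rightarrow> quat \<Rightarrow> quat" where
  "p div q = p * inverse (q :: quat)"

instance
proof
  fix a b c :: quat
  note defs = plus_quat_def zero_quat_def uminus_quat_def minus_quat_def one_quat_def times_quat_def
  show "a + b + c = a + (b + c)" by (simp add: defs)
  show "a + b = b + a" by (simp add: defs)
  show "0 + a = a" by (simp add: defs)
  show "- a + a = 0" by (simp add: defs)
  show "a - b = a + - b" by (simp add: defs)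
  show "1 * a = a" by (simp add: defs)
  show "a * 1 = a" by (simp add: defs)
  show "(0 :: quat) \<noteq> 1" by (simp add: defs)
  show "a * b * c = a * (b * c)" by (simp add: defs algebra_simps)
  show "(a + b) * c = a * c + b * c" by (simp add: defs algebra_simps)
  show "a * (b + c) = a * b + a * c" by (simp add: defs algebra_simps)
  show "a div b = a * inverse b" by (fact divide_quat_def)
  show "inverse (0 :: quat) = 0" by (simp add: inverse_quat_def zero_quat_def)
  assume "a \<noteq> 0"
  then have n: "qN a \<noteq> 0" by (simp add: qN_eq_0_iff zero_quat_def)
  have "qre a * qre a / qN a + qi a * qi a / qN a + qj a * qj a / qN a + qk a * qk a / qN a = 1"
    using n by (simp add: qN_def power2_eq_square flip: add_divide_distrib)
  then show "inverse a * a = 1" "a * inverse a = 1"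
    by (simp_all add: inverse_quat_def times_quat_def one_quat_def algebra_simps)
qed

end

definition hurwitz :: "quat set" where
  "hurwitz = {Quat (of_int a / 2) (of_int b / 2) (of_int c / 2) (of_int d / 2) | a b c d :: int.
     (even a \<longleftrightarrow> even b) \<and> (even b \<longleftrightarrow> even c) \<and> (even c \<longleftrightarrow> even d)}"

definition right_dvd :: "quat \<Rightarrow> quat \<Rightarrow> bool" where
  "right_dvd \<delta> \<alpha> \<longleftrightarrow> (\<exists>\<xi>\<in>hurwitz. \<alpha> = \<xi> * \<delta>)"

text \<open>Greatest common right divisors are only unique up to a left unit, so this is a relation.\<close>

definition is_right_gcd :: "quat \<Rightarrow> quat \<Rightarrow> quat \<Rightarrow> bool" where
  "is_right_gcd \<alpha> \<beta> \<delta> \<longleftrightarrow> \<delta> \<in> hurwitz \<and> right_dvd \<delta> \<alpha> \<and> right_dvd \<delta> \<beta> \<and>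
     (\<forall>\<delta>'\<in>hurwitz. right_dvd \<delta>' \<alpha> \<longrightarrow> right_dvd \<delta>' \<beta> \<longrightarrow> qN \<delta>' \<le> qN \<delta>)"

text \<open>Here $m = N(\mu)$, a natural number for the Hurwitz quaternions of interest;
  the floor only converts the type.\<close>

definition quad_r :: "quat \<Rightarrow> nat" where
  "quad_r \<mu> = (if \<lfloor>qN \<mu>\<rfloor> mod 4 = 3 then 2 else 1)"

definition quad_omega :: "quat \<Rightarrow> quat" where
  "quad_omega \<mu> = (of_nat (quad_r \<mu>) - 1 + \<mu>) / of_nat (quad_r \<mu>)"

definition quad_order :: "quat \<Rightarrow> quat set" where
  "quad_order \<mu> = {of_int x + of_int y * quad_omega \<mu> | x y :: int. True}"

definition quad_ring :: "quat \<Rightarrow> quat ring" where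
  "quad_ring \<mu> = \<lparr>carrier = quad_order \<mu>, monoid.mult = (*), one = 1, zero = 0, add = (+)\<rparr>"

definition nonzero_ideal :: "quat \<Rightarrow> quat set \<Rightarrow> bool" where
  "nonzero_ideal \<mu> I \<longleftrightarrow> ideal I (quad_ring \<mu>) \<and> I \<noteq> {0}"

text \<open>The set below is $c[a, b + \omega]$. The parameters $c$ and $a$ are determined by the
  ideal, and $b$ is determined modulo $a$.\<close>

definition right_pseudo_generator :: "quat \<Rightarrow> quat set \<Rightarrow> quat \<Rightarrow> bool" where
  "right_pseudo_generator \<mu> I \<rho> \<longleftrightarrow> nonzero_ideal \<mu> I \<and>
     (\<exists>a b c :: int. \<exists>\<delta>. c > 0 \<and> a > 0 \<and>
        I = {of_int c * (of_int x * of_int a + of_int y * (of_int b + quad_omega \<mu>)) | x y :: int. True} \<and>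
        is_right_gcd (of_int a) (of_int b + quad_omega \<mu>) \<delta> \<and>
        \<rho> = of_int c * \<delta>)"

definition R_ideal :: "quat \<Rightarrow> quat \<Rightarrow> quat set" where
  "R_ideal \<mu> \<rho> = {\<xi> * \<rho> | \<xi>. \<xi> \<in> hurwitz \<and> \<xi> * \<rho> \<in> quad_order \<mu>}"

definition ideal_equiv :: "quat \<Rightarrow> (quat set \<times> quat set) set" where
  "ideal_equiv \<mu> = {(I, J). nonzero_ideal \<mu> I \<and> nonzero_ideal \<mu> J \<and>
     (\<exists>\<alpha>\<in>quad_order \<mu> - {0}. \<exists>\<beta>\<in>quad_order \<mu> - {0}. (\<lambda>x. \<alpha> * x) ` I = (\<lambda>x. \<beta> * x) ` J)}"

definition ideal_class :: "quat \<Rightarrow> quat set \<Rightarrow> quat set set" where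
  "ideal_class \<mu> I = ideal_equiv \<mu> `` {I}"

definition ambiguous_class_of :: "quat \<Rightarrow> quat set \<Rightarrow> bool" where
  "ambiguous_class_of \<mu> I \<longleftrightarrow> ideal_class \<mu> I = ideal_class \<mu> (qcnj ` I)"

definition exactly_one_zero :: "real \<Rightarrow> real \<Rightarrow> real \<Rightarrow> bool" where
  "exactly_one_zero x y z \<longleftrightarrow>
     (x = 0 \<and> y \<noteq> 0 \<and> z \<noteq> 0) \<or> (x \<noteq> 0 \<and> y = 0 \<and> z \<noteq> 0) \<or> (x \<noteq> 0 \<and> y \<noteq> 0 \<and> z = 0)"

end

theory Submission
  imports Defs
begin

text \<open>
  Since $m$ is a squarefree sum of two nonzero squares, $\omega = \mu$, and $\mathcal O(\mu)$ is the
  centralizer of $\mu$ in $\mathcal H$. Some $e \in \{i,j,k\}$ anticommutes with $\mu$, so conjugation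
  by $e$ is the conjugation of $\mathcal O(\mu)$. If some $e' \in \{i,j,k\}$ anticommutes with $\mu'$,
  then $\beta = \overline\rho e' \rho e$ commutes with $\mu$, and $N(\rho)\overline{\mathfrak a} =
  \beta\mathfrak a$ for $\mathfrak a = R_\mu(\rho)$. Conversely, the left ideal
  $\mathcal H\mathfrak a$ is generated by $\rho$, so an equivalence $\alpha\overline{\mathfrak a} =
  \beta\mathfrak a$ yields a Hurwitz unit $u$ with $\rho e\alpha = u\rho\beta$. This $u$ anticommutes
  with $\mu'$; hence it is one of $\pm i, \pm j, \pm k$ and a coordinate of $\mu'$ vanishes. Two
  coordinates cannot vanish, because $m > 1$ is squarefree.
\<close>

section \<open>Quaternion arithmetic\<close>

lemmas quat_defs = zero_quat_def one_quat_def plus_quat_def uminus_quat_def minus_quat_def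
  times_quat_def

lemma of_nat_quat: "of_nat n = Quat (real n) 0 0 0"
  by (induction n) (simp_all add: quat_defs)

lemma of_int_quat: "of_int n = Quat (real_of_int n) 0 0 0"
  by (cases n) (simp_all add: of_nat_quat quat_defs)

lemma qN_mult: "qN (p * q) = qN p * qN q"
  by (simp add: qN_def times_quat_def power2_eq_square algebra_simps)

lemma qN_eq_0: "qN q = 0 \<longleftrightarrow> q = 0"
  by (simp add: qN_eq_0_iff zero_quat_def)

lemma qN_nonneg: "qN q \<ge> 0"
  by (simp add: qN_def)

lemma qN_one [simp]: "qN 1 = 1"
  by (simp add: qN_def one_quat_def)

lemma qN_conjugation: "r \<noteq> 0 \<Longrightarrow> qN (r * q * inverse r) = qN q"
proof -
  assume "r \<noteq> 0"
  then have "qN r * qN (inverse r) = 1"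
    by (metis qN_mult qN_one right_inverse)
  then show ?thesis
    by (simp add: qN_mult algebra_simps)
qed

lemma qre_mult_commute: "qre (p * q) = qre (q * p)"
  by (simp add: times_quat_def algebra_simps)

lemma qre_conjugation: "r \<noteq> 0 \<Longrightarrow> qre (r * q * inverse r) = qre q"
  by (metis qre_mult_commute mult.assoc left_inverse mult_1)

lemma qcnj_qcnj [simp]: "qcnj (qcnj q) = q"
  by (simp add: qcnj_def)

lemma qcnj_0 [simp]: "qcnj 0 = 0"
  by (simp add: qcnj_def quat_defs)

lemma qcnj_add: "qcnj (p + q) = qcnj p + qcnj q"
  by (simp add: qcnj_def quat_defs)

lemma qcnj_mult: "qcnj (p * q) = qcnj q * qcnj p"
  by (simp add: qcnj_def quat_defs algebra_simps)

lemma qcnj_mult_self: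
  assumes "qN q = of_int n"
  shows "qcnj q * q = of_int n" "q * qcnj q = of_int n"
  using assms by (simp_all add: qcnj_def times_quat_def of_int_quat qN_def power2_eq_square)

section \<open>Hurwitz quaternions\<close>

text \<open>The elements (1 + i + j + k)/2, i, j, k form a Z-basis of the Hurwitz quaternions. In
  these coordinates the parity conditions disappear, and closure under an operation only asks for
  four integer witnesses.\<close>

lemma hurwitz_iff:
  "x \<in> hurwitz \<longleftrightarrow> (\<exists>a b c d :: int.
     x = Quat (of_int a / 2) (of_int a / 2 + of_int b) (of_int a / 2 + of_int c) (of_int a / 2 + of_int d))"
proof
  assume "x \<in> hurwitz"
  then obtain a b c d :: int where x: "x = Quat (of_int a / 2) (of_int b / 2) (of_int c / 2) (of_int d / 2)"
    and "even (b - a)" "even (c - a)" "even (d - a)"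
    unfolding hurwitz_def by auto
  then obtain b' c' d' where "b - a = 2 * b'" "c - a = 2 * c'" "d - a = 2 * d'"
    by (meson evenE)
  then have "b = a + 2 * b'" "c = a + 2 * c'" "d = a + 2 * d'"
    by auto
  then have "x = Quat (of_int a / 2) (of_int a / 2 + of_int b') (of_int a / 2 + of_int c') (of_int a / 2 + of_int d')"
    by (simp add: x)
  then show "\<exists>a b c d :: int.
     x = Quat (of_int a / 2) (of_int a / 2 + of_int b) (of_int a / 2 + of_int c) (of_int a / 2 + of_int d)"
    by blast
next
  assume "\<exists>a b c d :: int.
     x = Quat (of_int a / 2) (of_int a / 2 + of_int b) (of_int a / 2 + of_int c) (of_int a / 2 + of_int d)"
  then obtain a b c d :: int where
    "x = Quat (of_int a / 2) (of_int a / 2 + of_int b) (of_int a / 2 + of_int c) (of_int a / 2 + of_int d)"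
    by blast
  then have "x = Quat (of_int a / 2) (of_int (a + 2 * b) / 2) (of_int (a + 2 * c) / 2) (of_int (a + 2 * d) / 2)"
    by simp
  moreover have "even (a + 2 * t) \<longleftrightarrow> even a" for t
    by simp
  ultimately show "x \<in> hurwitz"
    unfolding hurwitz_def by blast
qed

lemma hurwitz_Ints: "Quat (of_int a) (of_int b) (of_int c) (of_int d) \<in> hurwitz"
  unfolding hurwitz_iff
  by (rule exI[of _ "2 * a"], rule exI[of _ "b - a"], rule exI[of _ "c - a"], rule exI[of _ "d - a"]) simp

lemma hurwitz_of_int: "of_int n \<in> hurwitz"
  using hurwitz_Ints[of n 0 0 0] by (simp add: of_int_quat)

lemma hurwitz_0: "0 \<in> hurwitz" and hurwitz_1: "1 \<in> hurwitz"
  using hurwitz_of_int[of 0] hurwitz_of_int[of 1] by simp_all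

lemma hurwitz_add:
  assumes "x \<in> hurwitz" "y \<in> hurwitz"
  shows "x + y \<in> hurwitz"
proof -
  obtain a b c d a' b' c' d' :: int where
    "x = Quat (of_int a / 2) (of_int a / 2 + of_int b) (of_int a / 2 + of_int c) (of_int a / 2 + of_int d)"
    "y = Quat (of_int a' / 2) (of_int a' / 2 + of_int b') (of_int a' / 2 + of_int c') (of_int a' / 2 + of_int d')"
    using assms unfolding hurwitz_iff by blast
  then show ?thesis
    unfolding hurwitz_iff
    by (intro exI[of _ "a + a'"] exI[of _ "b + b'"] exI[of _ "c + c'"] exI[of _ "d + d'"])
      (simp add: plus_quat_def add_divide_distrib)
qed

lemma hurwitz_mult:
  assumes "x \<in> hurwitz" "y \<in> hurwitz"
  shows "x * y \<in> hurwitz"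
proof -
  obtain a b c d a' b' c' d' :: int where
    x: "x = Quat (of_int a / 2) (of_int a / 2 + of_int b) (of_int a / 2 + of_int c) (of_int a / 2 + of_int d)" and
    y: "y = Quat (of_int a' / 2) (of_int a' / 2 + of_int b') (of_int a' / 2 + of_int c') (of_int a' / 2 + of_int d')"
    using assms unfolding hurwitz_iff by blast
  \<comment> \<open>These are the coordinates of the product in that basis: \<open>A\<close> is
    twice the real part, and \<open>B\<close>, \<open>C\<close>, \<open>D\<close> are the imaginary
    parts minus the real part.\<close>
  define A where "A = - a*a' - a*b' - b*a' - a*c' - c*a' - a*d' - d*a' - 2*b*b' - 2*c*c' - 2*d*d'"
  define B where "B = a*a' + a*b' + b*a' + a*d' + c*a' + b*b' + c*c' + d*d' + c*d' - d*c'"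
  define C where "C = a*a' + a*c' + c*a' + a*b' + d*a' + b*b' + c*c' + d*d' + d*b' - b*d'"
  define D where "D = a*a' + a*d' + d*a' + a*c' + b*a' + b*b' + c*c' + d*d' + b*c' - c*b'"
  define t t' where "t = (of_int a / 2 :: real)" and "t' = (of_int a' / 2 :: real)"
  have a: "real_of_int a = 2 * t" "real_of_int a' = 2 * t'"
    by (simp_all add: t_def t'_def)
  have "x * y = Quat (of_int A / 2) (of_int A / 2 + of_int B) (of_int A / 2 + of_int C) (of_int A / 2 + of_int D)"
    unfolding x y times_quat_def quat.inject quat.sel A_def B_def C_def D_def of_int_add of_int_diff
      of_int_mult of_int_minus of_int_numeral a
    by (intro conjI; simp add: field_simps)
  then show ?thesis
    unfolding hurwitz_iff by blast
qed

lemma hurwitz_uminus: "x \<in> hurwitz \<Longrightarrow> - x \<in> hurwitz"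
  using hurwitz_mult[OF hurwitz_of_int[of "-1"]] by simp

lemma hurwitz_diff: "x \<in> hurwitz \<Longrightarrow> y \<in> hurwitz \<Longrightarrow> x - y \<in> hurwitz"
  using hurwitz_add[OF _ hurwitz_uminus] by fastforce

text \<open>The conjugate is the trace minus the element, and the trace of a Hurwitz quaternion is
  an integer.\<close>

lemma hurwitz_qcnj:
  assumes "x \<in> hurwitz"
  shows "qcnj x \<in> hurwitz"
proof -
  have "qcnj x = Quat (of_int a) 0 0 0 - x" if "2 * qre x = of_int a" for a
    using that by (simp add: qcnj_def minus_quat_def)
  moreover obtain a :: int where "2 * qre x = of_int a"
    using assms by (auto simp: hurwitz_def)
  ultimately show ?thesis
    using hurwitz_diff[OF hurwitz_of_int[of a] assms] by (simp add: of_int_quat)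
qed

text \<open>In the basis of \<open>hurwitz_iff\<close> the norm is a quadratic form with integer
  coefficients. Natural norms are what allows choosing an element of least norm and recognizing
  units by their norm.\<close>

lemma qN_hurwitz:
  assumes "x \<in> hurwitz"
  obtains n :: nat where "qN x = real n"
proof -
  obtain a b c d :: int where
    "x = Quat (of_int a / 2) (of_int a / 2 + of_int b) (of_int a / 2 + of_int c) (of_int a / 2 + of_int d)"
    using assms unfolding hurwitz_iff by blast
  then have "qN x = of_int (a*a + a*b + a*c + a*d + b*b + c*c + d*d)"
    by (simp add: qN_def power2_eq_square field_simps)
  then have "qN x = real (nat (a*a + a*b + a*c + a*d + b*b + c*c + d*d))"
    by (metis qN_nonneg of_int_0_le_iff of_nat_nat)
  then show ?thesis
    by (rule that)
qed

text \<open>The coordinates differ by integers, so they are all integral or all half-odd. In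
  particular real part 0 makes the other three integral.\<close>

lemma hurwitz_integer_coords:
  assumes "x \<in> hurwitz" "qre x \<in> \<int> \<or> qi x \<in> \<int> \<or> qj x \<in> \<int> \<or> qk x \<in> \<int>"
  obtains a b c d :: int where "x = Quat (of_int a) (of_int b) (of_int c) (of_int d)"
proof -
  obtain a b c d :: int where
    x: "x = Quat (of_int a / 2) (of_int a / 2 + of_int b) (of_int a / 2 + of_int c) (of_int a / 2 + of_int d)"
    using assms unfolding hurwitz_iff by blast
  have "of_int a / 2 + of_int t \<in> (\<int> :: real set) \<Longrightarrow> of_int a / 2 \<in> (\<int> :: real set)" for t
    by (metis Ints_diff Ints_of_int add_diff_cancel_right')
  then have "of_int a / 2 \<in> (\<int> :: real set)"
    using assms(2) x by auto
  then obtain s where "of_int a / 2 = (of_int s :: real)"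
    by (elim Ints_cases)
  with x show ?thesis
    using that[of s "s + b" "s + c" "s + d"] by simp
qed

section \<open>Euclidean division and the right Bezout identity\<close>

lemma round_error_square_le: "((t :: real) - of_int (round t))\<^sup>2 \<le> 1 / 4"
proof -
  have "\<bar>t - of_int (round t)\<bar> \<le> 1 / 2"
    using of_int_round_abs_le[of t] by (simp add: abs_minus_commute)
  then have "\<bar>t - of_int (round t)\<bar>\<^sup>2 \<le> (1 / 2)\<^sup>2"
    by (intro power_mono) auto
  then show ?thesis
    by (simp add: power2_eq_square)
qed

lemma half_odd_of_round_error:
  assumes "((t :: real) - of_int (round t))\<^sup>2 = 1 / 4"
  obtains a :: int where "odd a" "t = of_int a / 2"
proof -
  have "(t - of_int (round t))\<^sup>2 = (1 / 2)\<^sup>2"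
    using assms by (simp add: power2_eq_square)
  then have "t = of_int (2 * round t + 1) / 2 \<or> t = of_int (2 * round t - 1) / 2"
    unfolding power2_eq_iff by auto
  then show ?thesis
    using that[of "2 * round t + 1"] that[of "2 * round t - 1"] by force
qed

text \<open>Rounding every coordinate leaves an error of norm at most 4 * (1/4) = 1. Equality forces
  all four coordinates to be half-odd, and then x is itself a Hurwitz quaternion and is its own
  approximation.\<close>

lemma hurwitz_covering:
  obtains h where "h \<in> hurwitz" "qN (x - h) < 1"
proof (cases x)
  case (Quat t a b c)
  let ?h = "Quat (of_int (round t)) (of_int (round a)) (of_int (round b)) (of_int (round c))"
  have N: "qN (x - ?h) = (t - of_int (round t))\<^sup>2 + (a - of_int (round a))\<^sup>2
      + (b - of_int (round b))\<^sup>2 + (c - of_int (round c))\<^sup>2"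
    by (simp add: Quat qN_def minus_quat_def)
  show ?thesis
  proof (cases "qN (x - ?h) < 1")
    case True
    then show ?thesis
      using that hurwitz_Ints by blast
  next
    case False
    then have "(t - of_int (round t))\<^sup>2 = 1 / 4" "(a - of_int (round a))\<^sup>2 = 1 / 4"
      "(b - of_int (round b))\<^sup>2 = 1 / 4" "(c - of_int (round c))\<^sup>2 = 1 / 4"
      using N round_error_square_le[of t] round_error_square_le[of a] round_error_square_le[of b]
        round_error_square_le[of c] by linarith+
    then obtain t' a' b' c' :: int where "odd t'" "odd a'" "odd b'" "odd c'"
      "t = of_int t' / 2" "a = of_int a' / 2" "b = of_int b' / 2" "c = of_int c' / 2"
      by (meson half_odd_of_round_error)
    then have "x \<in> hurwitz"
      unfolding hurwitz_def Quat by blast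
    then show ?thesis
      using that[of x] by (simp add: qN_eq_0[THEN iffD2])
  qed
qed

lemma hurwitz_division:
  assumes "d \<noteq> 0"
  obtains h where "h \<in> hurwitz" "qN (x - h * d) < qN d"
proof -
  obtain h where h: "h \<in> hurwitz" "qN (x * inverse d - h) < 1"
    by (rule hurwitz_covering)
  have "x - h * d = (x * inverse d - h) * d"
    using assms by (simp add: left_diff_distrib mult.assoc)
  moreover have "qN d > 0"
    using assms qN_nonneg[of d] qN_eq_0[of d] by linarith
  ultimately have "qN (x - h * d) < qN d"
    using h(2) by (simp add: qN_mult)
  with h(1) show ?thesis
    by (rule that)
qed

text \<open>\<open>is_right_gcd\<close> only asks for maximal norm among common right divisors. By
  Euclidean division, a nonzero element \<gamma> of least norm in the left ideal generated by
  \<alpha> and \<beta> is a common right divisor, so its norm is at most that of \<delta>. But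
  \<gamma> is also a left multiple of \<delta>, hence a unit multiple, and \<delta> lies in the left
  ideal too.\<close>

lemma right_gcd_bezout:
  assumes "is_right_gcd \<alpha> \<beta> \<delta>" "\<alpha> \<in> hurwitz" "\<beta> \<in> hurwitz" "\<alpha> \<noteq> 0"
  obtains p q where "p \<in> hurwitz" "q \<in> hurwitz" "\<delta> = p * \<alpha> + q * \<beta>"
proof -
  define L where "L = {p * \<alpha> + q * \<beta> | p q. p \<in> hurwitz \<and> q \<in> hurwitz}"
  have \<alpha>L: "\<alpha> \<in> L" and \<beta>L: "\<beta> \<in> L"
    unfolding L_def using hurwitz_0 hurwitz_1 by force+
  have L_mult: "h * x \<in> L" if h: "h \<in> hurwitz" and x: "x \<in> L" for h x
  proof -
    obtain p q where "x = p * \<alpha> + q * \<beta>" "p \<in> hurwitz" "q \<in> hurwitz"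
      using x by (auto simp: L_def)
    then have "h * x = (h * p) * \<alpha> + (h * q) * \<beta>" "h * p \<in> hurwitz" "h * q \<in> hurwitz"
      using h by (simp_all add: distrib_left mult.assoc hurwitz_mult)
    then show ?thesis
      unfolding L_def by blast
  qed
  have L_diff: "x - y \<in> L" if x: "x \<in> L" and y: "y \<in> L" for x y
  proof -
    obtain p q p' q' where "x = p * \<alpha> + q * \<beta>" "p \<in> hurwitz" "q \<in> hurwitz"
      "y = p' * \<alpha> + q' * \<beta>" "p' \<in> hurwitz" "q' \<in> hurwitz"
      using x y by (auto simp: L_def)
    then have "x - y = (p - p') * \<alpha> + (q - q') * \<beta>" "p - p' \<in> hurwitz" "q - q' \<in> hurwitz"
      by (simp_all add: left_diff_distrib hurwitz_diff)
    then show ?thesis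
      unfolding L_def by blast
  qed
  have L_hurwitz: "L \<subseteq> hurwitz"
    unfolding L_def using assms(2,3) by (auto intro: hurwitz_add hurwitz_mult)
  \<comment> \<open>The measure must be a natural number; on \<open>L\<close> the norm is one
    already, so rounding down loses nothing.\<close>
  define \<gamma> where "\<gamma> = arg_min (\<lambda>x. nat \<lfloor>qN x\<rfloor>) (\<lambda>x. x \<in> L \<and> x \<noteq> 0)"
  have \<gamma>: "\<gamma> \<in> L" "\<gamma> \<noteq> 0"
    using arg_min_natI[of "\<lambda>x. x \<in> L \<and> x \<noteq> 0" \<alpha> "\<lambda>x. nat \<lfloor>qN x\<rfloor>"] \<alpha>L assms(4)
    by (auto simp: \<gamma>_def)
  have \<gamma>_min: "qN \<gamma> \<le> qN x" if x: "x \<in> L" "x \<noteq> 0" for x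
  proof -
    have "nat \<lfloor>qN \<gamma>\<rfloor> \<le> nat \<lfloor>qN x\<rfloor>"
      using arg_min_nat_le[of "\<lambda>x. x \<in> L \<and> x \<noteq> 0" x "\<lambda>x. nat \<lfloor>qN x\<rfloor>"] x by (auto simp: \<gamma>_def)
    moreover obtain n k :: nat where "qN \<gamma> = real n" "qN x = real k"
      by (meson L_hurwitz \<gamma>(1) x(1) qN_hurwitz subsetD)
    ultimately show ?thesis
      by simp
  qed
  have dvd: "right_dvd \<gamma> x" if x: "x \<in> L" for x
  proof -
    obtain h where h: "h \<in> hurwitz" "qN (x - h * \<gamma>) < qN \<gamma>"
      using hurwitz_division[OF \<gamma>(2)] .
    then have "x - h * \<gamma> = 0"
      using \<gamma>_min[of "x - h * \<gamma>"] L_diff[OF x L_mult[OF h(1) \<gamma>(1)]] by force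
    then show ?thesis
      unfolding right_dvd_def using h(1) by auto
  qed
  have "\<gamma> \<in> hurwitz"
    using \<gamma>(1) L_hurwitz by blast
  then have le: "qN \<gamma> \<le> qN \<delta>"
    using assms(1) dvd \<alpha>L \<beta>L unfolding is_right_gcd_def by blast
  obtain x y where xy: "x \<in> hurwitz" "y \<in> hurwitz" "\<alpha> = x * \<delta>" "\<beta> = y * \<delta>"
    using assms(1) unfolding is_right_gcd_def right_dvd_def by blast
  obtain p q where "p \<in> hurwitz" "q \<in> hurwitz" "\<gamma> = p * \<alpha> + q * \<beta>"
    using \<gamma>(1) unfolding L_def by blast
  then obtain \<xi> where \<xi>: "\<xi> \<in> hurwitz" "\<gamma> = \<xi> * \<delta>"
    using xy by (intro that[of "p * x + q * y"]) (simp_all add: distrib_right mult.assoc hurwitz_add hurwitz_mult)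
  obtain n :: nat where n: "qN \<xi> = real n"
    using qN_hurwitz[OF \<xi>(1)] .
  have pos: "qN \<delta> > 0" "qN \<xi> > 0"
    using \<gamma>(2) \<xi>(2) qN_nonneg[of \<delta>] qN_nonneg[of \<xi>] qN_eq_0[of \<delta>] qN_eq_0[of \<xi>] by auto
  \<comment> \<open>The cofactor \<xi> has positive norm at most 1, so it is a unit with inverse
    \<open>qcnj \<xi>\<close>.\<close>
  have "qN \<xi> * qN \<delta> \<le> 1 * qN \<delta>"
    using le by (simp add: \<xi>(2) qN_mult)
  then have "qN \<xi> \<le> 1"
    using pos(1) by (simp only: mult_le_cancel_right_pos)
  then have "qN \<xi> = of_int 1"
    using n pos(2) by simp
  then have "qcnj \<xi> * \<gamma> = \<delta>"
    using qcnj_mult_self(1) by (simp add: \<xi>(2) flip: mult.assoc)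
  then have "\<delta> \<in> L"
    using L_mult[OF hurwitz_qcnj[OF \<xi>(1)] \<gamma>(1)] by simp
  then show ?thesis
    unfolding L_def using that by blast
qed

section \<open>The order and its ideals\<close>

lemma exactly_one_zero_anticommute:
  assumes "exactly_one_zero x y z"
  obtains e where "e \<in> hurwitz" "e * e = - 1" "e * Quat 0 x y z = - (Quat 0 x y z * e)"
proof -
  have "Quat 0 1 0 0 \<in> hurwitz" "Quat 0 0 1 0 \<in> hurwitz" "Quat 0 0 0 1 \<in> hurwitz"
    using hurwitz_Ints[of 0 1 0 0] hurwitz_Ints[of 0 0 1 0] hurwitz_Ints[of 0 0 0 1] by simp_all
  then show ?thesis
    using assms that[of "Quat 0 1 0 0"] that[of "Quat 0 0 1 0"] that[of "Quat 0 0 0 1"]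
    unfolding exactly_one_zero_def by (auto simp: quat_defs)
qed

text \<open>Anticommuting with a nonzero pure v makes u pure and orthogonal to v. A pure Hurwitz
  unit is a signed basis unit, so orthogonality says that the matching coordinate of v is
  zero.\<close>

lemma anticommuting_unit_imp_exactly_one_zero:
  assumes "u \<in> hurwitz" "qN u = 1" "u * v = - (v * u)" "v \<in> hurwitz" "qre v = 0"
    and "qN v = real m" "squarefree m" "m > 1"
  shows "exactly_one_zero (qi v) (qj v) (qk v)"
proof -
  obtain t x y z :: int where v: "v = Quat (of_int t) (of_int x) (of_int y) (of_int z)"
    using hurwitz_integer_coords[OF assms(4)] assms(5) by (metis Ints_0)
  have t: "t = 0"
    using assms(5) v by simp
  have N: "int m = x\<^sup>2 + y\<^sup>2 + z\<^sup>2"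
  proof -
    have "of_int (int m) = (of_int (x\<^sup>2 + y\<^sup>2 + z\<^sup>2) :: real)"
      using assms(6) by (simp add: v t qN_def)
    then show ?thesis
      by (simp only: of_int_eq_iff)
  qed
  \<comment> \<open>For pure v, the imaginary part of uv + vu is 2 Re(u) v, and its real part is
    minus twice the scalar product of the imaginary parts.\<close>
  have anti: "qre u * of_int x = 0" "qre u * of_int y = 0" "qre u * of_int z = 0"
    "qi u * of_int x + qj u * of_int y + qk u * of_int z = 0"
    using assms(3) unfolding v t by (simp_all add: quat_defs)
  have "x \<noteq> 0 \<or> y \<noteq> 0 \<or> z \<noteq> 0"
    using N assms(8) by auto
  then have "qre u = 0"
    using anti by auto
  then obtain s a b c :: int where u: "u = Quat (of_int s) (of_int a) (of_int b) (of_int c)"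
    using hurwitz_integer_coords[OF assms(1)] by (metis Ints_0)
  have s: "s = 0"
    using u \<open>qre u = 0\<close> by simp
  have abc: "a\<^sup>2 + b\<^sup>2 + c\<^sup>2 = 1"
  proof -
    have "of_int (a\<^sup>2 + b\<^sup>2 + c\<^sup>2) = (of_int 1 :: real)"
      using assms(2) by (simp add: u s qN_def)
    then show ?thesis
      by (simp only: of_int_eq_iff)
  qed
  have orth: "a * x + b * y + c * z = 0"
  proof -
    have "of_int (a * x + b * y + c * z) = (of_int 0 :: real)"
      using anti(4) by (simp add: u)
    then show ?thesis
      by (simp only: of_int_eq_iff)
  qed
  have sq: "w\<^sup>2 \<ge> 1" if "w \<noteq> 0" for w :: int
    using that by (simp add: int_one_le_iff_zero_less)
  \<comment> \<open>Three integer squares with sum 1 have only one nonzero term.\<close>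
  have "a = 0 \<or> b = 0" "a = 0 \<or> c = 0" "b = 0 \<or> c = 0"
    using abc sq[of a] sq[of b] sq[of c] zero_le_power2[of a] zero_le_power2[of b] zero_le_power2[of c]
    by linarith+
  moreover have "a \<noteq> 0 \<or> b \<noteq> 0 \<or> c \<noteq> 0"
    using abc by auto
  ultimately have one: "x = 0 \<or> y = 0 \<or> z = 0"
    using orth by auto
  \<comment> \<open>If m were w^2, squarefreeness would give |w| = 1 and m = 1. This excludes two
    vanishing coordinates, which would leave m equal to the square of the third.\<close>
  have not_square: "int m \<noteq> w\<^sup>2" for w :: int
  proof
    assume "int m = w\<^sup>2"
    moreover have "int ((nat \<bar>w\<bar>)\<^sup>2) = w\<^sup>2"
      by simp
    ultimately have w: "m = (nat \<bar>w\<bar>)\<^sup>2"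
      by (metis of_nat_eq_iff)
    then have "(nat \<bar>w\<bar>)\<^sup>2 dvd m"
      by simp
    then have "nat \<bar>w\<bar> = 1"
      using assms(7) unfolding squarefree_def by (metis nat_dvd_1_iff_1)
    then show False
      using w assms(8) by simp
  qed
  have "\<not> (x = 0 \<and> y = 0)" "\<not> (x = 0 \<and> z = 0)" "\<not> (y = 0 \<and> z = 0)"
    using N not_square[of x] not_square[of y] not_square[of z] by auto
  then show ?thesis
    using one unfolding exactly_one_zero_def v by auto
qed

section \<open>The order as the centralizer of \<mu>\<close>

lemma squarefree_sum_two_squares_coprime:
  fixes a b :: int
  assumes "squarefree m" "int m = a\<^sup>2 + b\<^sup>2"
  shows "coprime a b"
proof -
  have "(gcd a b)\<^sup>2 dvd int m"
    unfolding assms(2) by (intro dvd_add dvd_power_same) auto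
  then have "int ((nat (gcd a b))\<^sup>2) dvd int m"
    by simp
  then have "(nat (gcd a b))\<^sup>2 dvd m"
    by (simp only: int_dvd_int_iff)
  then have "nat (gcd a b) dvd 1"
    using assms(1) unfolding squarefree_def by blast
  then have "nat (gcd a b) = 1"
    by simp
  then show ?thesis
    by (simp add: coprime_iff_gcd_eq_1 nat_eq_iff)
qed

text \<open>This excludes the case r = 2 in the definition of the order.\<close>

lemma sum_two_squares_mod_4: "((a :: int)\<^sup>2 + b\<^sup>2) mod 4 \<noteq> 3"
proof -
  have "w\<^sup>2 mod 4 = 0 \<or> w\<^sup>2 mod 4 = 1" for w :: int
  proof (cases "even w")
    case True
    then show ?thesis by (auto elim!: evenE)
  next
    case False
    then obtain k where "w = 2 * k + 1" by (elim oddE)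
    then have "w\<^sup>2 = 1 + 4 * (k\<^sup>2 + k)" by (simp add: power2_eq_square algebra_simps)
    then show ?thesis by presburger
  qed
  from this[of a] this[of b] show ?thesis
    by presburger
qed

lemma pure_hurwitz_two_coords:
  assumes "Quat 0 x y z \<in> hurwitz" "real m = qN (Quat 0 x y z)" "squarefree m" "exactly_one_zero x y z"
  obtains (coords) a b :: int where "a \<noteq> 0" "b \<noteq> 0" "coprime a b" "int m = a\<^sup>2 + b\<^sup>2"
    "(x, y, z) \<in> {(0, of_int a, of_int b), (of_int a, 0, of_int b), (of_int a, of_int b, 0)}"
proof -
  obtain t p q r :: int where pqr: "Quat 0 x y z = Quat (of_int t) (of_int p) (of_int q) (of_int r)"
    using hurwitz_integer_coords[OF assms(1)] by (metis Ints_0 quat.sel(1))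
  then have xyz: "x = of_int p" "y = of_int q" "z = of_int r"
    by simp_all
  have "real_of_int (int m) = of_int (p\<^sup>2 + q\<^sup>2 + r\<^sup>2)"
    using assms(2) by (simp add: xyz qN_def)
  then have m: "int m = p\<^sup>2 + q\<^sup>2 + r\<^sup>2"
    by (simp only: of_int_eq_iff)
  \<comment> \<open>Coprimality is supplied here once, so that each position of the zero only has to
    name the two remaining coordinates.\<close>
  have main: thesis if "a \<noteq> 0" "b \<noteq> 0" "int m = a\<^sup>2 + b\<^sup>2"
    "(x, y, z) \<in> {(0, of_int a, of_int b), (of_int a, 0, of_int b), (of_int a, of_int b, 0)}" for a b :: int
    using that squarefree_sum_two_squares_coprime[OF assms(3) that(3)] by (intro coords)
  from assms(4) consider "p = 0" "q \<noteq> 0" "r \<noteq> 0" | "p \<noteq> 0" "q = 0" "r \<noteq> 0" | "p \<noteq> 0" "q \<noteq> 0" "r = 0"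
    unfolding exactly_one_zero_def xyz by auto
  then show thesis
  proof cases
    case 1
    then show ?thesis by (intro main[of q r]) (simp_all add: m xyz)
  next
    case 2
    then show ?thesis by (intro main[of p r]) (simp_all add: m xyz)
  next
    case 3
    then show ?thesis by (intro main[of p q]) (simp_all add: m xyz)
  qed
qed

lemma quad_omega_eq:
  assumes "Quat 0 x y z \<in> hurwitz" "real m = qN (Quat 0 x y z)" "squarefree m" "exactly_one_zero x y z"
  shows "quad_omega (Quat 0 x y z) = Quat 0 x y z"
proof -
  obtain a b :: int where "int m = a\<^sup>2 + b\<^sup>2"
    using pure_hurwitz_two_coords[OF assms] by metis
  then have "int m mod 4 \<noteq> 3"
    using sum_two_squares_mod_4[of a b] by (simp only: not_False_eq_True)
  moreover have "\<lfloor>qN (Quat 0 x y z)\<rfloor> = int m"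
    unfolding assms(2)[symmetric] by (rule floor_of_nat)
  ultimately have "quad_r (Quat 0 x y z) = 1"
    unfolding quad_r_def by presburger
  then show ?thesis
    by (simp add: quad_omega_def)
qed

text \<open>An h commuting with \<mu> has imaginary part parallel to \<mu>, and the coprime
  coordinates of \<mu> make the factor an integer. Membership in the order thus becomes a Hurwitz
  condition together with a commutation test.\<close>

lemma quad_order_eq_centralizer:
  assumes "Quat 0 x y z \<in> hurwitz" "real m = qN (Quat 0 x y z)" "squarefree m" "exactly_one_zero x y z"
  shows "quad_order (Quat 0 x y z) = {h \<in> hurwitz. h * Quat 0 x y z = Quat 0 x y z * h}"
    (is "quad_order ?\<mu> = ?C")
proof
  show "quad_order ?\<mu> \<subseteq> ?C"
    using assms(1) unfolding quad_order_def quad_omega_eq[OF assms]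
    by (auto intro!: hurwitz_add hurwitz_mult hurwitz_of_int
        simp: distrib_left distrib_right mult.assoc mult_of_int_commute)
next
  show "?C \<subseteq> quad_order ?\<mu>"
  proof
    fix h
    assume "h \<in> ?C"
    then have h: "h \<in> hurwitz" and comm: "h * ?\<mu> = ?\<mu> * h"
      by auto
    obtain a b :: int where ab: "a \<noteq> 0" "b \<noteq> 0" "coprime a b"
      and xyz: "(x, y, z) \<in> {(0, of_int a, of_int b), (of_int a, 0, of_int b), (of_int a, of_int b, 0)}"
      using pure_hurwitz_two_coords[OF assms] by metis
    \<comment> \<open>Commuting means that the cross product of the imaginary parts
      vanishes.\<close>
    have cross: "qj h * z = qk h * y" "qi h * z = qk h * x" "qi h * y = qj h * x"
      using comm by (auto simp: times_quat_def mult.commute)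
    \<comment> \<open>The coordinate of h at the zero of \<mu> vanishes, which rules out half-odd
      coordinates.\<close>
    then have "qi h = 0 \<or> qj h = 0 \<or> qk h = 0"
      using xyz ab by auto
    then obtain s p q r :: int where h_eq: "h = Quat (of_int s) (of_int p) (of_int q) (of_int r)"
      using hurwitz_integer_coords[OF h] by (metis Ints_0)
    \<comment> \<open>Proportionality to the coprime pair (a, b) has an integer factor, since a
      divides v * b and hence v.\<close>
    have multiple: "\<exists>t. v = t * a \<and> w = t * b" if "real_of_int v * of_int b = of_int w * of_int a" for v w
    proof -
      have eq: "v * b = w * a"
        using that by (metis of_int_eq_iff of_int_mult)
      then have "a dvd v"
        using ab(3) by (metis coprime_dvd_mult_left_iff dvd_triv_right)
      then obtain t where "v = t * a"
        by (metis dvd_def mult.commute)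
      with eq ab(1) show ?thesis
        by auto
    qed
    have "\<exists>t :: int. of_int p = of_int t * x \<and> of_int q = of_int t * y \<and> of_int r = of_int t * z"
      using xyz cross ab unfolding h_eq by (auto dest: multiple)
    then obtain t :: int where "of_int p = of_int t * x" "of_int q = of_int t * y" "of_int r = of_int t * z"
      by blast
    then have "h = of_int s + of_int t * ?\<mu>"
      by (simp add: h_eq of_int_quat quat_defs)
    then show "h \<in> quad_order ?\<mu>"
      unfolding quad_order_def quad_omega_eq[OF assms] by blast
  qed
qed

section \<open>Ideals of the order, their conjugates and their classes\<close>

lemma nonzero_ideal_closed:
  assumes "nonzero_ideal \<mu> I"
  shows "I \<subseteq> quad_order \<mu>"
    and "x \<in> I \<Longrightarrow> y \<in> quad_order \<mu> \<Longrightarrow> x * y \<in> I"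
proof -
  interpret ideal I "quad_ring \<mu>"
    using assms by (simp add: nonzero_ideal_def)
  show "I \<subseteq> quad_order \<mu>"
    using a_subset by (simp add: quad_ring_def)
  show "x \<in> I \<Longrightarrow> y \<in> quad_order \<mu> \<Longrightarrow> x * y \<in> I"
    using I_r_closed[of x y] by (simp add: quad_ring_def)
qed

lemma quad_order_of_int: "of_int n \<in> quad_order \<mu>"
  unfolding quad_order_def by (rule CollectI, rule exI[of _ n], rule exI[of _ 0]) simp

lemma quad_order_one: "1 \<in> quad_order \<mu>" and quad_order_minus_one: "- 1 \<in> quad_order \<mu>"
  using quad_order_of_int[of 1] quad_order_of_int[of "-1"] by simp_all

text \<open>\<open>ideal_equiv\<close> relates nonzero ideals only, so the class of the conjugate
  set is meaningful only once this is known. Conjugation reverses products; commutativity then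
  provides absorption on both sides.\<close>

lemma nonzero_ideal_qcnj:
  assumes ideal: "nonzero_ideal \<mu> I"
    and cnj: "\<And>x. x \<in> quad_order \<mu> \<Longrightarrow> qcnj x \<in> quad_order \<mu>"
    and comm: "\<And>x y. x \<in> quad_order \<mu> \<Longrightarrow> y \<in> quad_order \<mu> \<Longrightarrow> x * y = y * x"
  shows "nonzero_ideal \<mu> (qcnj ` I)"
proof -
  interpret ideal I "quad_ring \<mu>"
    using ideal by (simp add: nonzero_ideal_def)
  note sub = nonzero_ideal_closed(1)[OF ideal]
  have uminus: "- x \<in> I" if "x \<in> I" for x
    using nonzero_ideal_closed(2)[OF ideal that quad_order_minus_one] by simp
  have "ideal (qcnj ` I) (quad_ring \<mu>)"
  proof (rule idealI)
    show "ring (quad_ring \<mu>)"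
      by unfold_locales
    show "subgroup (qcnj ` I) (add_monoid (quad_ring \<mu>))"
    proof (rule group.subgroupI)
      show "Group.group (add_monoid (quad_ring \<mu>))"
        by (rule a_group)
      show "qcnj ` I \<subseteq> carrier (add_monoid (quad_ring \<mu>))"
        using sub cnj by (auto simp: quad_ring_def)
      show "qcnj ` I \<noteq> {}"
        using additive_subgroup.zero_closed[OF is_additive_subgroup] by blast
      fix u v
      assume "u \<in> qcnj ` I" "v \<in> qcnj ` I"
      then obtain x y where xy: "x \<in> I" "y \<in> I" "u = qcnj x" "v = qcnj y"
        by blast
      then have "x + y \<in> I"
        using additive_subgroup.a_closed[OF is_additive_subgroup, of x y] by (simp add: quad_ring_def)
      then show "u \<otimes>\<^bsub>add_monoid (quad_ring \<mu>)\<^esub> v \<in> qcnj ` I"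
        using xy by (simp add: quad_ring_def flip: qcnj_add)
    next
      fix u
      assume "u \<in> qcnj ` I"
      then obtain x where x: "x \<in> I" "u = qcnj x"
        by blast
      then have u: "u \<in> quad_order \<mu>"
        using sub cnj by blast
      \<comment> \<open>\<open>quad_ring\<close> records no negation, so the abstract additive
        inverse is identified with the quaternion negative through its defining equation.\<close>
      have "\<ominus>\<^bsub>quad_ring \<mu>\<^esub> u \<oplus>\<^bsub>quad_ring \<mu>\<^esub> u = \<zero>\<^bsub>quad_ring \<mu>\<^esub>"
        using u by (intro l_neg) (simp add: quad_ring_def)
      then have "\<ominus>\<^bsub>quad_ring \<mu>\<^esub> u = - u"
        by (simp add: quad_ring_def eq_neg_iff_add_eq_0)
      also have "\<dots> = qcnj (- x)"
        by (simp add: x(2) qcnj_def quat_defs)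
      also have "\<dots> \<in> qcnj ` I"
        using uminus[OF x(1)] by blast
      finally show "inv\<^bsub>add_monoid (quad_ring \<mu>)\<^esub> u \<in> qcnj ` I"
        by (simp add: a_inv_def)
    qed
  next
    fix u w
    assume "u \<in> qcnj ` I" and w: "w \<in> carrier (quad_ring \<mu>)"
    then obtain x where x: "x \<in> I" "u = qcnj x"
      by blast
    have w': "w \<in> quad_order \<mu>" "qcnj w \<in> quad_order \<mu>"
      using w cnj by (simp_all add: quad_ring_def)
    have "x * qcnj w \<in> I"
      using nonzero_ideal_closed(2)[OF ideal x(1) w'(2)] .
    moreover have "w * u = qcnj (x * qcnj w)"
      by (simp add: x(2) qcnj_mult)
    ultimately have wu: "w * u \<in> qcnj ` I"
      by blast
    then show "w \<otimes>\<^bsub>quad_ring \<mu>\<^esub> u \<in> qcnj ` I"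
      by (simp add: quad_ring_def)
    have "u \<in> quad_order \<mu>"
      using x sub cnj by blast
    then show "u \<otimes>\<^bsub>quad_ring \<mu>\<^esub> w \<in> qcnj ` I"
      using wu comm w'(1) by (simp add: quad_ring_def)
  qed
  moreover have "qcnj ` I \<noteq> {0}"
  proof
    assume "qcnj ` I = {0}"
    then have "qcnj ` qcnj ` I = {0}"
      by simp
    then show False
      using ideal by (simp add: image_image nonzero_ideal_def)
  qed
  ultimately show ?thesis
    by (simp add: nonzero_ideal_def)
qed

text \<open>The relation is an equivalence on nonzero ideals, so equal classes mean related
  representatives. Transitivity crosses the two pairs of multipliers, which needs a commutative
  order without zero divisors.\<close>

lemma ideal_class_eq_iff:
  assumes ideals: "nonzero_ideal \<mu> I" "nonzero_ideal \<mu> J"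
    and mult: "\<And>x y. x \<in> quad_order \<mu> \<Longrightarrow> y \<in> quad_order \<mu> \<Longrightarrow> x * y \<in> quad_order \<mu>"
    and comm: "\<And>x y. x \<in> quad_order \<mu> \<Longrightarrow> y \<in> quad_order \<mu> \<Longrightarrow> x * y = y * x"
  shows "ideal_class \<mu> I = ideal_class \<mu> J \<longleftrightarrow>
    (\<exists>\<alpha>\<in>quad_order \<mu> - {0}. \<exists>\<beta>\<in>quad_order \<mu> - {0}. (\<lambda>x. \<alpha> * x) ` I = (\<lambda>x. \<beta> * x) ` J)"
proof -
  have refl': "(K, K) \<in> ideal_equiv \<mu>" if "nonzero_ideal \<mu> K" for K
    using that quad_order_one[of \<mu>] unfolding ideal_equiv_def
    by (intro CollectI case_prodI conjI bexI[of _ 1] refl) simp_all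
  have symm: "(K, I) \<in> ideal_equiv \<mu>" if "(I, K) \<in> ideal_equiv \<mu>" for I K
    using that unfolding ideal_equiv_def mem_Collect_eq case_prod_conv by (metis (no_types, lifting))
  have trans: "(I, L) \<in> ideal_equiv \<mu>" if IK: "(I, K) \<in> ideal_equiv \<mu>" and KL: "(K, L) \<in> ideal_equiv \<mu>" for I K L
  proof -
    obtain \<alpha> \<beta> where \<alpha>\<beta>: "\<alpha> \<in> quad_order \<mu> - {0}" "\<beta> \<in> quad_order \<mu> - {0}"
      "(\<lambda>x. \<alpha> * x) ` I = (\<lambda>x. \<beta> * x) ` K"
      using IK by (auto simp: ideal_equiv_def)
    obtain \<gamma> \<delta> where \<gamma>\<delta>: "\<gamma> \<in> quad_order \<mu> - {0}" "\<delta> \<in> quad_order \<mu> - {0}"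
      "(\<lambda>x. \<gamma> * x) ` K = (\<lambda>x. \<delta> * x) ` L"
      using KL by (auto simp: ideal_equiv_def)
    have "(\<lambda>x. (\<gamma> * \<alpha>) * x) ` I = (\<lambda>x. \<gamma> * x) ` ((\<lambda>x. \<alpha> * x) ` I)"
      by (simp add: image_image mult.assoc)
    also have "\<dots> = (\<lambda>x. (\<gamma> * \<beta>) * x) ` K"
      by (simp add: \<alpha>\<beta>(3) image_image mult.assoc)
    also have "\<dots> = (\<lambda>x. \<beta> * x) ` ((\<lambda>x. \<gamma> * x) ` K)"
      using comm[of \<gamma> \<beta>] \<alpha>\<beta>(2) \<gamma>\<delta>(1) by (simp add: image_image flip: mult.assoc)
    also have "\<dots> = (\<lambda>x. (\<beta> * \<delta>) * x) ` L"
      by (simp add: \<gamma>\<delta>(3) image_image mult.assoc)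
    finally have "(\<lambda>x. (\<gamma> * \<alpha>) * x) ` I = (\<lambda>x. (\<beta> * \<delta>) * x) ` L" .
    moreover have "\<gamma> * \<alpha> \<in> quad_order \<mu> - {0}" "\<beta> * \<delta> \<in> quad_order \<mu> - {0}"
      using \<alpha>\<beta> \<gamma>\<delta> mult by auto
    moreover have "nonzero_ideal \<mu> I" "nonzero_ideal \<mu> L"
      using IK KL by (auto simp: ideal_equiv_def)
    ultimately show ?thesis
      unfolding ideal_equiv_def by blast
  qed
  have "ideal_class \<mu> I = ideal_class \<mu> J \<longleftrightarrow> (I, J) \<in> ideal_equiv \<mu>"
  proof
    assume "ideal_class \<mu> I = ideal_class \<mu> J"
    then show "(I, J) \<in> ideal_equiv \<mu>"
      unfolding ideal_class_def using refl'[OF ideals(2)] by blast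
  next
    assume "(I, J) \<in> ideal_equiv \<mu>"
    then have "(I, K) \<in> ideal_equiv \<mu> \<longleftrightarrow> (J, K) \<in> ideal_equiv \<mu>" for K
      using symm trans by metis
    then show "ideal_class \<mu> I = ideal_class \<mu> J"
      unfolding ideal_class_def by blast
  qed
  then show ?thesis
    using ideals by (simp add: ideal_equiv_def)
qed

section \<open>The two implications\<close>

text \<open>The three positions of the zero coordinate enter the rest of the argument only through
  the unit e. Both descriptions of the order are kept: the centralizer tests membership, the Z-basis
  computes conjugates.\<close>

locale order_conjugated_by_unit =
  fixes \<mu> e :: quat
  assumes e_hurwitz: "e \<in> hurwitz"
    and e_square: "e * e = - 1"
    and e_mu: "e * \<mu> = - (\<mu> * e)"
    and order_eq: "quad_order \<mu> = {h \<in> hurwitz. h * \<mu> = \<mu> * h}"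
    and order_def: "quad_order \<mu> = {of_int x + of_int y * \<mu> | x y :: int. True}"
    and mu_pure: "qre \<mu> = 0"
begin

lemma order_commute:
  assumes "x \<in> quad_order \<mu>" "y \<in> quad_order \<mu>"
  shows "x * y = y * x"
proof -
  obtain s t :: int where y: "y = of_int s + of_int t * \<mu>"
    using assms(2) by (auto simp: order_def)
  have "x * \<mu> = \<mu> * x"
    using assms(1) by (simp add: order_eq)
  then have "x * (of_int t * \<mu>) = of_int t * \<mu> * x"
    by (metis mult.assoc mult_of_int_commute)
  then show ?thesis
    by (simp add: y distrib_left distrib_right mult_of_int_commute)
qed

lemma order_mult: "x \<in> quad_order \<mu> \<Longrightarrow> y \<in> quad_order \<mu> \<Longrightarrow> x * y \<in> quad_order \<mu>"
  by (auto simp: order_eq hurwitz_mult) (metis mult.assoc)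

lemma qcnj_mu: "qcnj \<mu> = - \<mu>"
  using mu_pure by (simp add: qcnj_def quat_defs)

lemma order_qcnj:
  assumes "x \<in> quad_order \<mu>"
  shows "qcnj x \<in> quad_order \<mu>"
proof -
  have "qcnj (x * \<mu>) = qcnj (\<mu> * x)"
    using assms by (simp add: order_eq)
  then show ?thesis
    using assms by (simp add: order_eq qcnj_mult qcnj_mu hurwitz_qcnj)
qed

lemma e_qcnj:
  assumes "x \<in> quad_order \<mu>"
  shows "e * qcnj x = x * e"
proof -
  obtain s t :: int where x: "x = of_int s + of_int t * \<mu>"
    using assms by (auto simp: order_def)
  have "qcnj (of_int n) = of_int n" for n
    by (simp add: of_int_quat qcnj_def)
  then have "qcnj x = of_int s - of_int t * \<mu>"
    by (simp add: x qcnj_add qcnj_mult qcnj_mu mult_of_int_commute)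
  then have "e * qcnj x = of_int s * e - of_int t * (e * \<mu>)"
    by (simp add: right_diff_distrib flip: mult_of_int_commute mult.assoc)
  then show ?thesis
    by (simp add: e_mu x distrib_right mult.assoc)
qed

text \<open>The inverse of e is -e, so on the order conjugation is multiplication by Hurwitz units
  from both sides. This turns statements about conjugates into statements about left
  multiples.\<close>

lemma qcnj_eq: "x \<in> quad_order \<mu> \<Longrightarrow> qcnj x = - (e * x * e)"
  using e_qcnj[of x] e_square by (metis minus_minus minus_mult_left mult.assoc mult_1)

text \<open>Both b and h * b commute with \<mu>, and a nonzero b can be cancelled in a division
  ring, so h commutes with \<mu> as well.\<close>

lemma order_cancel:
  assumes "h \<in> hurwitz" "b \<in> quad_order \<mu>" "b \<noteq> 0" "h * b \<in> quad_order \<mu>"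
  shows "h \<in> quad_order \<mu>"
proof -
  have "h * \<mu> * b = h * b * \<mu>"
    using assms(2) by (simp add: order_eq mult.assoc)
  also have "\<dots> = \<mu> * h * b"
    using assms(4) by (simp add: order_eq mult.assoc)
  finally show ?thesis
    using assms by (simp add: order_eq)
qed

text \<open>Multiplication by \<beta> sends h \<rho> to N(\<rho>) times the conjugate of (e h e')
  \<rho>. The map taking h to e h e' preserves the Hurwitz quaternions and is its own inverse
  because both units square to -1, so both inclusions follow.\<close>

lemma conjugate_equivalent_if_anticommute:
  assumes \<rho>: "\<rho> \<in> hurwitz" "\<rho> \<noteq> 0"
    and \<mu>': "\<rho> * \<mu> = \<mu>' * \<rho>"
    and e': "e' \<in> hurwitz" "e' * e' = - 1" "e' * \<mu>' = - (\<mu>' * e')"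
  shows "\<exists>\<alpha>\<in>quad_order \<mu> - {0}. \<exists>\<beta>\<in>quad_order \<mu> - {0}.
    (\<lambda>x. \<alpha> * x) ` R_ideal \<mu> \<rho> = (\<lambda>x. \<beta> * x) ` qcnj ` R_ideal \<mu> \<rho>"
proof -
  obtain n' :: nat where n': "qN \<rho> = real n'"
    using qN_hurwitz[OF \<rho>(1)] .
  define n where "n = int n'"
  have n: "qN \<rho> = of_int n"
    by (simp add: n' n_def)
  note cnj = qcnj_mult_self[OF n]
  have n_comm: "of_int n * x = x * of_int n" for x :: quat
    by (simp add: mult_of_int_commute)
  define N where "N = (of_int n :: quat)"
  have N0: "N \<noteq> 0"
    unfolding N_def using cnj(1) \<rho>(2) by (metis qcnj_qcnj qcnj_0 mult_eq_0_iff)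
  have N: "N \<in> quad_order \<mu>"
    by (simp add: N_def quad_order_of_int)
  define \<beta> where "\<beta> = qcnj \<rho> * e' * \<rho> * e"
  \<comment> \<open>As \<open>qcnj \<rho> * \<rho>\<close> is a central integer,
    \<open>qcnj \<rho>\<close> intertwines \<mu>' and \<mu> in the opposite direction.\<close>
  have cnj_\<mu>': "qcnj \<rho> * \<mu>' = \<mu> * qcnj \<rho>"
  proof -
    have "qcnj \<rho> * \<mu>' * \<rho> = qcnj \<rho> * \<rho> * \<mu>"
      by (simp add: \<mu>' mult.assoc)
    also have "\<dots> = \<mu> * qcnj \<rho> * \<rho>"
      by (simp add: cnj n_comm mult.assoc)
    finally show ?thesis
      using \<rho>(2) by simp
  qed
  \<comment> \<open>Moving \<mu> to the left through \<beta> changes the sign at e and again at e',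
    so \<beta> commutes with \<mu>.\<close>
  have "\<beta> * \<mu> = - (qcnj \<rho> * e' * (\<rho> * \<mu>) * e)"
    by (simp add: \<beta>_def mult.assoc e_mu)
  also have "\<dots> = - (qcnj \<rho> * (e' * \<mu>') * \<rho> * e)"
    by (simp add: \<mu>' mult.assoc)
  also have "\<dots> = (qcnj \<rho> * \<mu>') * e' * \<rho> * e"
    by (simp add: e' mult.assoc)
  also have "\<dots> = \<mu> * \<beta>"
    by (simp add: cnj_\<mu>' \<beta>_def mult.assoc)
  finally have \<beta>: "\<beta> \<in> quad_order \<mu>"
    by (simp add: order_eq \<beta>_def hurwitz_mult hurwitz_qcnj \<rho> e' e_hurwitz)
  have "e \<noteq> 0" "e' \<noteq> 0"
    using e_square e'(2) by auto
  moreover have "qcnj \<rho> \<noteq> 0"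
    using \<rho>(2) by (metis qcnj_qcnj qcnj_0)
  ultimately have \<beta>0: "\<beta> \<noteq> 0"
    using \<rho>(2) by (simp add: \<beta>_def)
  have mul_\<beta>: "h * \<rho> * \<beta> = N * (h * e' * \<rho> * e)" for h
  proof -
    have "h * \<rho> * \<beta> = h * (\<rho> * qcnj \<rho>) * e' * \<rho> * e"
      by (simp add: \<beta>_def mult.assoc)
    then show ?thesis
      by (simp add: cnj N_def mult.assoc flip: n_comm)
  qed
  have "(\<lambda>x. \<beta> * x) ` R_ideal \<mu> \<rho> = (\<lambda>x. N * x) ` qcnj ` R_ideal \<mu> \<rho>"
  proof (intro equalityI subsetI)
    fix w
    assume "w \<in> (\<lambda>x. \<beta> * x) ` R_ideal \<mu> \<rho>"
    then obtain h where h: "h \<in> hurwitz" "h * \<rho> \<in> quad_order \<mu>" "w = \<beta> * (h * \<rho>)"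
      by (auto simp: R_ideal_def)
    define v where "v = h * e' * \<rho> * e"
    have w: "w = N * v"
      using order_commute[OF \<beta> h(2)] mul_\<beta>[of h] by (simp add: h(3) v_def)
    have "v \<in> hurwitz"
      by (simp add: v_def hurwitz_mult h \<rho> e' e_hurwitz)
    \<comment> \<open>Since v * N equals w, it lies in the order, and cancelling N puts v
      there.\<close>
    moreover have "v * N \<in> quad_order \<mu>"
      using w h(2,3) order_mult[OF \<beta>] by (metis N_def n_comm)
    ultimately have v: "v \<in> quad_order \<mu>"
      using order_cancel N N0 by blast
    have "qcnj v = (e * h * e') * \<rho>"
      using qcnj_eq[OF v] e_square by (simp add: v_def mult.assoc)
    moreover have "e * h * e' \<in> hurwitz"
      by (simp add: hurwitz_mult h e' e_hurwitz)
    ultimately have "qcnj v \<in> R_ideal \<mu> \<rho>"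
      unfolding R_ideal_def using order_qcnj[OF v] by force
    then show "w \<in> (\<lambda>x. N * x) ` qcnj ` R_ideal \<mu> \<rho>"
      using w by (metis image_eqI qcnj_qcnj)
  next
    fix w
    assume "w \<in> (\<lambda>x. N * x) ` qcnj ` R_ideal \<mu> \<rho>"
    then obtain h where h: "h \<in> hurwitz" "h * \<rho> \<in> quad_order \<mu>" "w = N * qcnj (h * \<rho>)"
      by (auto simp: R_ideal_def)
    define y where "y = e * h * e' * \<rho>"
    have "y * \<beta> = N * (e * h * (e' * e') * \<rho> * e)"
      using mul_\<beta>[of "e * h * e'"] by (simp add: y_def mult.assoc)
    then have y\<beta>: "y * \<beta> = w"
      using qcnj_eq[OF h(2)] by (simp add: h(3) e'(2) mult.assoc)
    have "w \<in> quad_order \<mu>"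
      using h N order_mult order_qcnj by blast
    moreover have "y \<in> hurwitz"
      by (simp add: y_def hurwitz_mult h \<rho> e' e_hurwitz)
    ultimately have y: "y \<in> quad_order \<mu>"
      using order_cancel \<beta> \<beta>0 y\<beta> by blast
    moreover have "e * h * e' \<in> hurwitz"
      by (simp add: hurwitz_mult h e' e_hurwitz)
    ultimately have "y \<in> R_ideal \<mu> \<rho>"
      unfolding R_ideal_def y_def by blast
    then show "w \<in> (\<lambda>x. \<beta> * x) ` R_ideal \<mu> \<rho>"
      using y\<beta> order_commute[OF \<beta> y] by (metis image_eqI)
  qed
  then show ?thesis
    using \<beta> \<beta>0 N N0 by blast
qed

text \<open>The equivalence makes X e \<alpha> a left multiple of \<rho> \<beta>, and X \<beta> a
  left multiple of \<rho> e \<alpha>, for each X in the ideal. The Bezout identity carries both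
  facts over to \<rho>, which itself need not lie in the ideal.\<close>

lemma anticommuting_unit_if_conjugate_equivalent:
  assumes \<rho>: "\<rho> \<noteq> 0"
    and \<mu>': "\<rho> * \<mu> = \<mu>' * \<rho>"
    and bezout: "\<rho> = p * A + q * B" "p \<in> hurwitz" "q \<in> hurwitz" "A \<in> R_ideal \<mu> \<rho>" "B \<in> R_ideal \<mu> \<rho>"
    and \<alpha>: "\<alpha> \<in> quad_order \<mu>" "\<alpha> \<noteq> 0" and \<beta>: "\<beta> \<in> quad_order \<mu>" "\<beta> \<noteq> 0"
    and equiv: "(\<lambda>x. \<alpha> * x) ` qcnj ` R_ideal \<mu> \<rho> = (\<lambda>x. \<beta> * x) ` R_ideal \<mu> \<rho>"
  obtains u where "u \<in> hurwitz" "qN u = 1" "u * \<mu>' = - (\<mu>' * u)"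
proof -
  let ?I = "R_ideal \<mu> \<rho>"
  have I: "x \<in> quad_order \<mu>" if "x \<in> ?I" for x
    using that by (auto simp: R_ideal_def)
  have step1: "\<exists>h\<in>hurwitz. X * e * \<alpha> = h * (\<rho> * \<beta>)" if X: "X \<in> ?I" for X
  proof -
    obtain Y where Y: "Y \<in> ?I" "\<alpha> * qcnj X = \<beta> * Y"
      using equiv X by (metis (no_types, lifting) imageE imageI)
    obtain \<eta> where \<eta>: "\<eta> \<in> hurwitz" "Y = \<eta> * \<rho>"
      using Y(1) by (auto simp: R_ideal_def)
    \<comment> \<open>Moving e to the left conjugates X, and the conjugate is what the equivalence
      controls.\<close>
    have "X * e * \<alpha> = e * (qcnj X * \<alpha>)"
      using e_qcnj[OF I[OF X]] by (simp flip: mult.assoc)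
    also have "qcnj X * \<alpha> = Y * \<beta>"
      using Y order_commute[OF order_qcnj[OF I[OF X]] \<alpha>(1)] order_commute[OF I[OF Y(1)] \<beta>(1)] by simp
    also have "e * (Y * \<beta>) = (e * \<eta>) * (\<rho> * \<beta>)"
      by (simp add: \<eta> mult.assoc)
    finally show ?thesis
      using hurwitz_mult[OF e_hurwitz \<eta>(1)] by blast
  qed
  have step2: "\<exists>h\<in>hurwitz. X * \<beta> = h * (\<rho> * e * \<alpha>)" if X: "X \<in> ?I" for X
  proof -
    obtain Y where Y: "Y \<in> ?I" "\<alpha> * qcnj Y = \<beta> * X"
      using equiv X by (smt (verit) imageE imageI)
    obtain \<eta> where \<eta>: "\<eta> \<in> hurwitz" "Y = \<eta> * \<rho>"
      using Y(1) by (auto simp: R_ideal_def)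
    have "X * \<beta> = qcnj Y * \<alpha>"
      using Y order_commute[OF order_qcnj[OF I[OF Y(1)]] \<alpha>(1)] order_commute[OF I[OF X] \<beta>(1)] by simp
    also have "\<dots> = - (e * Y * e) * \<alpha>"
      by (simp only: qcnj_eq[OF I[OF Y(1)]])
    also have "\<dots> = (- (e * \<eta>)) * (\<rho> * e * \<alpha>)"
      by (simp add: \<eta>(2) mult.assoc)
    finally show ?thesis
      using hurwitz_uminus[OF hurwitz_mult[OF e_hurwitz \<eta>(1)]] by blast
  qed
  obtain a b where ab: "a \<in> hurwitz" "b \<in> hurwitz" "A * e * \<alpha> = a * (\<rho> * \<beta>)" "B * e * \<alpha> = b * (\<rho> * \<beta>)"
    using step1[OF bezout(4)] step1[OF bezout(5)] by blast
  define u where "u = p * a + q * b"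
  have "\<rho> * e * \<alpha> = p * (A * e * \<alpha>) + q * (B * e * \<alpha>)"
    by (subst bezout(1)) (simp add: distrib_right mult.assoc)
  then have u: "\<rho> * e * \<alpha> = u * (\<rho> * \<beta>)"
    unfolding ab by (simp add: u_def distrib_right mult.assoc)
  have u_hurwitz: "u \<in> hurwitz"
    by (simp add: u_def hurwitz_add hurwitz_mult ab bezout)
  obtain c d where cd: "c \<in> hurwitz" "d \<in> hurwitz" "A * \<beta> = c * (\<rho> * e * \<alpha>)" "B * \<beta> = d * (\<rho> * e * \<alpha>)"
    using step2[OF bezout(4)] step2[OF bezout(5)] by blast
  define v where "v = p * c + q * d"
  have "\<rho> * \<beta> = p * (A * \<beta>) + q * (B * \<beta>)"
    by (subst bezout(1)) (simp add: distrib_right mult.assoc)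
  then have v: "\<rho> * \<beta> = v * (\<rho> * e * \<alpha>)"
    unfolding cd by (simp add: v_def distrib_right mult.assoc)
  have v_hurwitz: "v \<in> hurwitz"
    by (simp add: v_def hurwitz_add hurwitz_mult cd bezout)
  have nz: "\<rho> * \<beta> \<noteq> 0"
    using \<rho> \<beta>(2) by simp
  \<comment> \<open>Each of \<open>\<rho> * \<beta>\<close> and \<open>\<rho> * e * \<alpha>\<close>
    is a left multiple of the other, so the cofactors are mutually inverse and their natural norms
    have product 1.\<close>
  have "1 * (\<rho> * \<beta>) = (v * u) * (\<rho> * \<beta>)"
    using u v by (simp add: mult.assoc)
  then have "v * u = 1"
    using nz by (metis mult_right_cancel)
  then have "qN v * qN u = 1"
    by (metis qN_mult qN_one)
  moreover obtain k l :: nat where "qN v = real k" "qN u = real l"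
    using qN_hurwitz[OF u_hurwitz] qN_hurwitz[OF v_hurwitz] by metis
  ultimately have "qN u = 1"
    by (metis nat_mult_eq_1_iff of_nat_1 of_nat_eq_iff of_nat_mult)
  moreover have "u * \<mu>' = - (\<mu>' * u)"
  proof -
    have \<beta>\<mu>: "\<beta> * \<mu> = \<mu> * \<beta>" and \<alpha>\<mu>: "\<alpha> * \<mu> = \<mu> * \<alpha>"
      using \<alpha>(1) \<beta>(1) by (simp_all add: order_eq)
    \<comment> \<open>Tested on the nonzero \<open>\<rho> * \<beta>\<close>: \<mu>' becomes \<mu>
      when it passes \<rho>, commutes with \<beta> and \<alpha>, and changes sign at e.\<close>
    have "u * \<mu>' * (\<rho> * \<beta>) = u * (\<mu>' * \<rho>) * \<beta>"
      by (simp add: mult.assoc)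
    also have "\<dots> = u * (\<rho> * \<beta>) * \<mu>"
      by (simp add: \<beta>\<mu> mult.assoc flip: \<mu>')
    also have "\<dots> = \<rho> * (e * \<mu>) * \<alpha>"
      by (simp add: \<alpha>\<mu> mult.assoc flip: u)
    also have "\<dots> = - (\<rho> * \<mu>) * e * \<alpha>"
      by (simp add: e_mu mult.assoc)
    also have "\<dots> = - \<mu>' * (\<rho> * e * \<alpha>)"
      by (simp add: \<mu>' mult.assoc)
    also have "\<dots> = - (\<mu>' * u) * (\<rho> * \<beta>)"
      unfolding u by (simp add: mult.assoc)
    finally show ?thesis
      using nz by (metis mult_right_cancel)
  qed
  ultimately show ?thesis
    using that u_hurwitz by blast
qed

end

text \<open>The Bezout identity for the gcd \<delta>, scaled by the central integer c, writes \<rho>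
  through the Z-basis c a, c (b + \<omega>) of the ideal. Thus \<rho> lies in the left Hurwitz ideal
  generated by I.\<close>

lemma right_pseudo_generator_bezout:
  assumes "right_pseudo_generator \<mu> I \<rho>" "quad_omega \<mu> \<in> hurwitz"
  obtains p q A B where "\<rho> = p * A + q * B" "p \<in> hurwitz" "q \<in> hurwitz" "A \<in> I" "B \<in> I"
    "\<rho> \<in> hurwitz" "\<rho> \<noteq> 0"
proof -
  obtain a b c :: int and \<delta> where abc: "c > 0" "a > 0"
    and I: "I = {of_int c * (of_int x * of_int a + of_int y * (of_int b + quad_omega \<mu>)) | x y :: int. True}"
    and gcd: "is_right_gcd (of_int a) (of_int b + quad_omega \<mu>) \<delta>" and \<rho>: "\<rho> = of_int c * \<delta>"
    using assms(1) unfolding right_pseudo_generator_def by blast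
  let ?\<beta> = "of_int b + quad_omega \<mu>"
  have nz: "of_int n \<noteq> (0 :: quat)" if "n > 0" for n :: int
    using that by (simp add: of_int_quat zero_quat_def)
  obtain p q where pq: "p \<in> hurwitz" "q \<in> hurwitz" "\<delta> = p * of_int a + q * ?\<beta>"
    using right_gcd_bezout[OF gcd hurwitz_of_int hurwitz_add[OF hurwitz_of_int assms(2)] nz[OF abc(2)]] .
  have "of_int c * \<delta> = \<delta> * of_int c"
    by (rule mult_of_int_commute)
  also have "\<dots> = p * (of_int a * of_int c) + q * (?\<beta> * of_int c)"
    by (simp add: pq(3) distrib_right mult.assoc)
  also have "\<dots> = p * (of_int c * of_int a) + q * (of_int c * ?\<beta>)"
    by (simp only: mult_of_int_commute[of c])
  finally have "\<rho> = p * (of_int c * of_int a) + q * (of_int c * ?\<beta>)"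
    by (simp add: \<rho>)
  moreover have "of_int c * of_int a \<in> I"
    unfolding I by (rule CollectI, rule exI[of _ 1], rule exI[of _ 0]) simp
  moreover have "of_int c * ?\<beta> \<in> I"
    unfolding I by (rule CollectI, rule exI[of _ 0], rule exI[of _ 1]) simp
  moreover have "\<rho> \<in> hurwitz"
    using gcd by (simp add: \<rho> is_right_gcd_def hurwitz_mult hurwitz_of_int)
  \<comment> \<open>It right-divides the positive integer a.\<close>
  moreover have "\<delta> \<noteq> 0"
    using gcd nz[OF abc(2)] by (auto simp: is_right_gcd_def right_dvd_def)
  then have "\<rho> \<noteq> 0"
    using nz[OF abc(1)] by (simp add: \<rho>)
  ultimately show ?thesis
    using that pq(1,2) by blast
qed

theorem theorem6:
  fixes \<mu> \<mu>' \<rho> :: quat and x\<^sub>0 y\<^sub>0 z\<^sub>0 :: real and m :: nat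
  assumes "\<mu> \<in> hurwitz"
    and "\<mu> = Quat 0 x\<^sub>0 y\<^sub>0 z\<^sub>0"
    and "real m = qN \<mu>"
    and "squarefree m"
    and "exactly_one_zero x\<^sub>0 y\<^sub>0 z\<^sub>0"
    and "right_pseudo_generator \<mu> (R_ideal \<mu> \<rho>) \<rho>"
    and "\<mu>' = \<rho> * \<mu> * inverse \<rho>"
  shows "ambiguous_class_of \<mu> (R_ideal \<mu> \<rho>) \<longleftrightarrow> exactly_one_zero (qi \<mu>') (qj \<mu>') (qk \<mu>')"
proof -
  let ?I = "R_ideal \<mu> \<rho>"
  note hyps = assms(1,3,4,5)[unfolded assms(2)]
  have omega: "quad_omega \<mu> = \<mu>"
    using quad_omega_eq[OF hyps] by (simp add: assms(2))
  obtain e where e: "e \<in> hurwitz" "e * e = - 1" "e * \<mu> = - (\<mu> * e)"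
    using exactly_one_zero_anticommute[OF assms(5)] unfolding assms(2) by metis
  interpret order_conjugated_by_unit \<mu> e
  proof
    show "quad_order \<mu> = {h \<in> hurwitz. h * \<mu> = \<mu> * h}"
      using quad_order_eq_centralizer[OF hyps] by (simp add: assms(2))
    show "quad_order \<mu> = {of_int x + of_int y * \<mu> | x y :: int. True}"
      by (simp add: quad_order_def omega)
    show "qre \<mu> = 0"
      by (simp add: assms(2))
  qed (fact e)+
  obtain p q A B where bezout: "\<rho> = p * A + q * B" "p \<in> hurwitz" "q \<in> hurwitz" "A \<in> ?I" "B \<in> ?I"
    and \<rho>: "\<rho> \<in> hurwitz" "\<rho> \<noteq> 0"
    using right_pseudo_generator_bezout[OF assms(6)] assms(1) omega by metis
  have \<rho>\<mu>: "\<rho> * \<mu> = \<mu>' * \<rho>"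
    using \<rho>(2) by (simp add: assms(7) mult.assoc)
  have ideal: "nonzero_ideal \<mu> ?I"
    using assms(6) by (simp add: right_pseudo_generator_def)
  have "nonzero_ideal \<mu> (qcnj ` ?I)"
    by (rule nonzero_ideal_qcnj[OF ideal order_qcnj order_commute])
  then have amb: "ambiguous_class_of \<mu> ?I \<longleftrightarrow>
      (\<exists>\<alpha>\<in>quad_order \<mu> - {0}. \<exists>\<beta>\<in>quad_order \<mu> - {0}. (\<lambda>x. \<alpha> * x) ` ?I = (\<lambda>x. \<beta> * x) ` qcnj ` ?I)"
    unfolding ambiguous_class_of_def by (rule ideal_class_eq_iff[OF ideal _ order_mult order_commute])
  have "qre \<mu>' = 0"
    using qre_conjugation[OF \<rho>(2)] mu_pure by (simp add: assms(7))
  then have \<mu>'_eq: "\<mu>' = Quat 0 (qi \<mu>') (qj \<mu>') (qk \<mu>')"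
    by (cases \<mu>') simp
  show ?thesis
  proof
    assume "ambiguous_class_of \<mu> ?I"
    then obtain \<alpha> \<beta> where \<alpha>: "\<alpha> \<in> quad_order \<mu> - {0}" and \<beta>: "\<beta> \<in> quad_order \<mu> - {0}"
      and equiv: "(\<lambda>x. \<alpha> * x) ` ?I = (\<lambda>x. \<beta> * x) ` qcnj ` ?I"
      unfolding amb by (elim bexE)
    have nonzero: "\<alpha> \<in> quad_order \<mu>" "\<alpha> \<noteq> 0" "\<beta> \<in> quad_order \<mu>" "\<beta> \<noteq> 0"
      using \<alpha> \<beta> by simp_all
    \<comment> \<open>The lemma expects the conjugate ideal on the left, so \<alpha> and \<beta>
      exchange roles.\<close>
    obtain u where u: "u \<in> hurwitz" "qN u = 1" "u * \<mu>' = - (\<mu>' * u)"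
      using anticommuting_unit_if_conjugate_equivalent[OF \<rho>(2) \<rho>\<mu> bezout nonzero(3,4,1,2) equiv[symmetric]] .
    \<comment> \<open>The ideal absorbs \<mu>, so by the Bezout identity \<rho> \<mu> is a left
      multiple of \<rho>; its cofactor is \<mu>', which is therefore a Hurwitz quaternion.\<close>
    have "\<mu> \<in> quad_order \<mu>"
      using assms(1) by (simp add: order_eq)
    then have "A * \<mu> \<in> ?I" "B * \<mu> \<in> ?I"
      using nonzero_ideal_closed(2)[OF ideal] bezout(4,5) by blast+
    then obtain a b where ab: "a \<in> hurwitz" "b \<in> hurwitz" "A * \<mu> = a * \<rho>" "B * \<mu> = b * \<rho>"
      by (auto simp: R_ideal_def)
    have "\<rho> * \<mu> = p * (A * \<mu>) + q * (B * \<mu>)"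
      by (subst bezout(1)) (simp add: distrib_right mult.assoc)
    then have "\<mu>' * \<rho> = (p * a + q * b) * \<rho>"
      unfolding ab \<rho>\<mu> by (simp add: distrib_right mult.assoc)
    then have "\<mu>' \<in> hurwitz"
      using \<rho>(2) ab bezout(2,3) by (simp add: hurwitz_add hurwitz_mult)
    moreover have "m > 1"
    proof -
      obtain a b :: int where "a \<noteq> 0" "b \<noteq> 0" "int m = a\<^sup>2 + b\<^sup>2"
        using pure_hurwitz_two_coords[OF hyps] by metis
      moreover from this have "a\<^sup>2 > 0" "b\<^sup>2 > 0"
        by simp_all
      ultimately show ?thesis
        by linarith
    qed
    moreover have "qN \<mu>' = real m"
      using qN_conjugation[OF \<rho>(2)] assms(3) by (simp add: assms(7))
    ultimately show "exactly_one_zero (qi \<mu>') (qj \<mu>') (qk \<mu>')"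
      using anticommuting_unit_imp_exactly_one_zero[OF u] \<open>qre \<mu>' = 0\<close> assms(4) by blast
  next
    assume "exactly_one_zero (qi \<mu>') (qj \<mu>') (qk \<mu>')"
    then obtain e' where "e' \<in> hurwitz" "e' * e' = - 1" "e' * \<mu>' = - (\<mu>' * e')"
      using exactly_one_zero_anticommute[of "qi \<mu>'" "qj \<mu>'" "qk \<mu>'", folded \<mu>'_eq] by metis
    then show "ambiguous_class_of \<mu> ?I"
      unfolding amb by (rule conjugate_equivalent_if_anticommute[OF \<rho> \<rho>\<mu>])
  qed
qed

end
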